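(* Let $\mathcal{S}\subset \mathcal{LO}(\mathrm{Homeo}_+(\mathbb{R}))$ be the set of all standard dynamical-lexicographic orderings and let $\mathcal{G}$ be the set of all general dynamical-lexicographic orderings. Then the sequential closure of $\mathcal{S}$ in $\mathcal{LO}(\mathrm{Homeo}_+(\mathbb{R}))$ is $\mathcal{G}$: $\mathrm{sc}(\mathcal{S})=\mathcal{G}$.
   Context: $\mathrm{Homeo}_+(\mathbb{R})$ is the group (under composition) of orientation-preserving homeomorphisms of $\mathbb{R}$. A left-ordering on a group $G$ is a total order $\preceq$ on $G$ such that $f\prec g$ implies $hf\prec hg$ for all $f,g,h\in G$. $\mathcal{LO}(G)$ is the set of all left-orderings on $G$. For $S\subset G$, let $U_S$ be the set of left-orderings in which every element of $S$ is positive (strictly greater than the identity); $\mathcal{LO}(G)$ carries the topology with subbasis $\{U_S : S\subset G \text{ finite}\}$. Thus $\preceq_n\to\preceq$ iff for each $f\in G$ the sign of $f$ (positive, negative, or trivial) in $\preceq_n$ eventually equals its sign in $\preceq$. Standard dynamical-lexicographic ordering: given a sequence $\mathbf{x}=(x_n)_{n=1}^\infty$ dense in $\mathbb{R}$ and $\Omega:\mathbb{N}\to\{+,-\}$, the ordering $\preceq_{\mathbf{x},\Omega}$ on $\mathrm{Homeo}_+(\mathbb{R})$ is defined, for $f\ne g$, by $f\succ g$ iff either $f(x_n)>g(x_n)$ and $\Omega(n)=+$, or $f(x_n)<g(x_n)$ and $\Omega(n)=-$, where $n$ is the smallest index with $f(x_n)\neq g(x_n)$. General dynamical-lexicographic ordering: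 given a well-ordering $\leq_w$ of the set $\mathbb{R}$ and $\Omega:\mathbb{R}\to\{+,-\}$, the ordering $\preceq_{\leq_w,\Omega}$ on $\mathrm{Homeo}_+(\mathbb{R})$ is defined, for $f\neq g$, by $f\succ g$ iff either $f(x)>g(x)$ and $\Omega(x)=+$, or $f(x)<g(x)$ and $\Omega(x)=-$, where $x$ is the $\leq_w$-least point with $f(x)\ne g(x)$. The sequential closure $\mathrm{sc}(\mathcal{S})$ is the set of all limits in $\mathcal{LO}(\mathrm{Homeo}_+(\mathbb{R}))$ of convergent sequences of elements of $\mathcal{S}$. *)

theory Defs
  imports "HOL-Analysis.Analysis" "HOL-Algebra.Group"
begin

text \<open>
  An ordering of a group \<open>G\<close> is a relation on \<open>carrier G\<close>; membership \<open>(f, g) \<in> r\<close> means that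
  \<open>f\<close> is less than or equal to \<open>g\<close>.
\<close>

definition left_ordering :: "('a, 'b) monoid_scheme \<Rightarrow> 'a rel \<Rightarrow> bool" where
  "left_ordering G r \<longleftrightarrow>
     linear_order_on (carrier G) r \<and>
     (\<forall>f\<in>carrier G. \<forall>g\<in>carrier G. \<forall>h\<in>carrier G.
        (f, g) \<in> r \<and> f \<noteq> g \<longrightarrow>
        (h \<otimes>\<^bsub>G\<^esub> f, h \<otimes>\<^bsub>G\<^esub> g) \<in> r \<and> h \<otimes>\<^bsub>G\<^esub> f \<noteq> h \<otimes>\<^bsub>G\<^esub> g)"

definition LO :: "('a, 'b) monoid_scheme \<Rightarrow> 'a rel set" where
  "LO G = {r. left_ordering G r}"

definition LO_pos :: "('a, 'b) monoid_scheme \<Rightarrow> 'a set \<Rightarrow> 'a rel set" where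
  "LO_pos G S = {r \<in> LO G. \<forall>s\<in>S. (\<one>\<^bsub>G\<^esub>, s) \<in> r \<and> s \<noteq> \<one>\<^bsub>G\<^esub>}"

text \<open>The choice \<open>S = {}\<close> in the subbasis makes all of \<open>LO G\<close> open.\<close>

definition LO_topology :: "('a, 'b) monoid_scheme \<Rightarrow> 'a rel topology" where
  "LO_topology G = topology_generated_by {LO_pos G S | S. finite S \<and> S \<subseteq> carrier G}"

lemma topspace_LO_topology: "topspace (LO_topology G) = LO G"
proof -
  have "LO_pos G {} = LO G"
    by (simp add: LO_pos_def)
  then have "LO G \<in> {LO_pos G S | S. finite S \<and> S \<subseteq> carrier G}"
    by blast
  then show ?thesis
    unfolding LO_topology_def topology_generated_by_topspace by (auto simp: LO_pos_def)
qed

definition seq_closure :: "'a topology \<Rightarrow> 'a set \<Rightarrow> 'a set" where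
  "seq_closure X A = {l. \<exists>\<sigma> :: nat \<Rightarrow> 'a. range \<sigma> \<subseteq> A \<and> limitin X \<sigma> l sequentially}"

definition homeo_plus :: "(real \<Rightarrow> real) monoid" where
  "homeo_plus =
     \<lparr>carrier = {f. (\<exists>g. homeomorphism UNIV UNIV f g) \<and> strict_mono f},
      mult = (\<circ>), one = id\<rparr>"

lemma homeo_plus_simps:
  "f \<in> carrier homeo_plus \<longleftrightarrow> (\<exists>g. homeomorphism UNIV UNIV f g) \<and> strict_mono f"
  "f \<otimes>\<^bsub>homeo_plus\<^esub> g = f \<circ> g"
  "\<one>\<^bsub>homeo_plus\<^esub> = id"
  by (simp_all add: homeo_plus_def)

lemma group_homeo_plus: "group homeo_plus"
proof (rule groupI)
  fix f g assume "f \<in> carrier homeo_plus" "g \<in> carrier homeo_plus"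
  then show "f \<otimes>\<^bsub>homeo_plus\<^esub> g \<in> carrier homeo_plus"
    unfolding homeo_plus_simps by (metis homeomorphism_compose strict_mono_o)
next
  show "\<one>\<^bsub>homeo_plus\<^esub> \<in> carrier homeo_plus"
    unfolding homeo_plus_simps
    by (auto simp: strict_mono_def intro!: exI[of _ id] homeomorphismI)
next
  fix f assume "f \<in> carrier homeo_plus"
  then obtain g where g: "homeomorphism UNIV UNIV f g" and f: "strict_mono f"
    unfolding homeo_plus_simps by blast
  have fg: "f (g x) = x" and gf: "g (f x) = x" for x
    using g by (simp_all add: homeomorphism_def)
  have "strict_mono g"
    using f fg by (metis strict_mono_less strict_monoI)
  moreover have "homeomorphism UNIV UNIV g f"
    using g homeomorphism_sym by blast
  moreover have "g \<circ> f = id"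
    using gf by auto
  ultimately show "\<exists>y\<in>carrier homeo_plus. y \<otimes>\<^bsub>homeo_plus\<^esub> f = \<one>\<^bsub>homeo_plus\<^esub>"
    unfolding homeo_plus_simps by (metis homeo_plus_simps(1))
qed (auto simp: homeo_plus_simps)

datatype sign = Plus | Minus

definition std_dlo :: "(nat \<Rightarrow> real) \<Rightarrow> (nat \<Rightarrow> sign) \<Rightarrow> (real \<Rightarrow> real) rel" where
  "std_dlo x \<Omega> =
     {(g, f). g \<in> carrier homeo_plus \<and> f \<in> carrier homeo_plus \<and>
        (f = g \<or>
         (\<exists>n. f (x n) \<noteq> g (x n) \<and> (\<forall>m. f (x m) \<noteq> g (x m) \<longrightarrow> n \<le> m) \<and>
              (f (x n) > g (x n) \<and> \<Omega> n = Plus \<or> f (x n) < g (x n) \<and> \<Omega> n = Minus)))}"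

definition gen_dlo :: "real rel \<Rightarrow> (real \<Rightarrow> sign) \<Rightarrow> (real \<Rightarrow> real) rel" where
  "gen_dlo w \<Omega> =
     {(g, f). g \<in> carrier homeo_plus \<and> f \<in> carrier homeo_plus \<and>
        (f = g \<or>
         (\<exists>x. f x \<noteq> g x \<and> (\<forall>y. f y \<noteq> g y \<longrightarrow> (x, y) \<in> w) \<and>
              (f x > g x \<and> \<Omega> x = Plus \<or> f x < g x \<and> \<Omega> x = Minus)))}"

definition standard_dlos :: "(real \<Rightarrow> real) rel set" where
  "standard_dlos = {std_dlo x \<Omega> | x \<Omega>. closure (range x) = UNIV}"

definition general_dlos :: "(real \<Rightarrow> real) rel set" where
  "general_dlos = {gen_dlo w \<Omega> | w \<Omega>. well_order_on UNIV w}"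

lemma left_ordering_dlo_aux:
  fixes p :: "'i \<Rightarrow> real" and le :: "'i \<Rightarrow> 'i \<Rightarrow> bool" and \<Omega> :: "'i \<Rightarrow> sign"
  assumes least: "\<And>P. \<exists>i. P i \<Longrightarrow> \<exists>i. P i \<and> (\<forall>j. P j \<longrightarrow> le i j)"
    and le_antisym: "\<And>i j. le i j \<Longrightarrow> le j i \<Longrightarrow> i = j"
    and le_trans: "\<And>i j k. le i j \<Longrightarrow> le j k \<Longrightarrow> le i k"
    and sep: "\<And>f g. f \<in> carrier homeo_plus \<Longrightarrow> g \<in> carrier homeo_plus \<Longrightarrow> f \<noteq> g \<Longrightarrow>
                \<exists>i. f (p i) \<noteq> g (p i)"
  defines "L \<equiv> \<lambda>g f i. f (p i) \<noteq> g (p i) \<and> (\<forall>j. f (p j) \<noteq> g (p j) \<longrightarrow> le i j) \<and>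
              (f (p i) > g (p i) \<and> \<Omega> i = Plus \<or> f (p i) < g (p i) \<and> \<Omega> i = Minus)"
  defines "r \<equiv> {(g, f). g \<in> carrier homeo_plus \<and> f \<in> carrier homeo_plus \<and> (f = g \<or> (\<exists>i. L g f i))}"
  shows "r \<in> LO homeo_plus"
proof -
  have trich: "(\<exists>i. L g f i) \<or> (\<exists>i. L f g i)"
    if fg: "f \<in> carrier homeo_plus" "g \<in> carrier homeo_plus" "f \<noteq> g" for f g
  proof -
    obtain i where i: "f (p i) \<noteq> g (p i)" "\<forall>j. f (p j) \<noteq> g (p j) \<longrightarrow> le i j"
      using least[of "\<lambda>i. f (p i) \<noteq> g (p i)"] sep[OF fg] by blast
    then have "L g f i \<or> L f g i"
      unfolding L_def by (cases "\<Omega> i") (auto simp: neq_iff)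
    then show ?thesis by blast
  qed
  have asym: False if "L g f i" "L f g j" for f g i j
  proof -
    have "i = j" using that le_antisym unfolding L_def by metis
    then show False using that unfolding L_def by auto
  qed
  have tr: "\<exists>i. L f h i" if fg: "L f g i" and gh: "L g h j" for f g h i j
  proof -
    have tot: "le i j \<or> le j i"
      using least[of "\<lambda>k. k = i \<or> k = j"] by blast
    show ?thesis
    proof (cases "i = j")
      case True
      have fst: "\<forall>k. h (p k) \<noteq> f (p k) \<longrightarrow> le i k"
        using fg gh True unfolding L_def by metis
      have "L f h i"
        using fg gh fst unfolding L_def True by (cases "\<Omega> j") auto
      then show ?thesis ..
    next
      case neq: False
      show ?thesis
      proof (cases "le i j")
        case True
        then have "\<not> le j i" using neq le_antisym by blast
        then have e: "h (p i) = g (p i)" using gh unfolding L_def by metis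
        have fst: "\<forall>k. h (p k) \<noteq> f (p k) \<longrightarrow> le i k"
          using fg gh True le_trans unfolding L_def by metis
        have "L f h i"
          using fg e fst unfolding L_def by auto
        then show ?thesis ..
      next
        case False
        then have ji: "le j i" using tot by blast
        have e: "g (p j) = f (p j)" using fg False unfolding L_def by metis
        have fst: "\<forall>k. h (p k) \<noteq> f (p k) \<longrightarrow> le j k"
          using fg gh ji le_trans unfolding L_def by metis
        have "L f h j"
          using gh e fst unfolding L_def by auto
        then show ?thesis ..
      qed
    qed
  qed
  have "r \<subseteq> carrier homeo_plus \<times> carrier homeo_plus" "refl_on (carrier homeo_plus) r"
    unfolding r_def refl_on_def by auto
  moreover have "trans r"
    by (rule transI) (unfold r_def, use tr in blast)
  moreover have "antisym r"
    by (rule antisymI) (unfold r_def, use asym in blast)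
  moreover have "total_on (carrier homeo_plus) r"
    unfolding total_on_def r_def using trich by blast
  ultimately have lin: "linear_order_on (carrier homeo_plus) r"
    by (simp add: order_on_defs)
  have inv: "(h \<circ> f, h \<circ> g) \<in> r \<and> h \<circ> f \<noteq> h \<circ> g"
    if c: "f \<in> carrier homeo_plus" "g \<in> carrier homeo_plus" "h \<in> carrier homeo_plus"
      and fg: "(f, g) \<in> r" "f \<noteq> g" for f g h
  proof -
    obtain i where i: "L f g i" using fg unfolding r_def by auto
    have sm: "strict_mono h" using c(3) unfolding homeo_plus_simps by blast
    have e: "h a = h b \<longleftrightarrow> a = b" "h a < h b \<longleftrightarrow> a < b" for a b
      using sm by (simp_all add: strict_mono_eq strict_mono_less)
    have L: "L (h \<circ> f) (h \<circ> g) i"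
      using i unfolding L_def by (simp add: e)
    have "h \<circ> f \<in> carrier homeo_plus" "h \<circ> g \<in> carrier homeo_plus"
      using c group.is_monoid[OF group_homeo_plus] monoid.m_closed[of homeo_plus]
      by (metis homeo_plus_simps(2))+
    with L have "(h \<circ> f, h \<circ> g) \<in> r" unfolding r_def by blast
    moreover have "h \<circ> f \<noteq> h \<circ> g"
      using L unfolding L_def by metis
    ultimately show ?thesis by blast
  qed
  show ?thesis
    unfolding LO_def left_ordering_def mem_Collect_eq homeo_plus_simps(2)
    using lin inv by blast
qed

lemma standard_dlos_subset_LO: "standard_dlos \<subseteq> LO homeo_plus"
proof
  fix r assume "r \<in> standard_dlos"
  then obtain x \<Omega> where r: "r = std_dlo x \<Omega>" and dense: "closure (range x) = UNIV"
    unfolding standard_dlos_def by blast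
  show "r \<in> LO homeo_plus"
    unfolding r std_dlo_def
  proof (rule left_ordering_dlo_aux[where le = "(\<le>)"])
    show "\<exists>i. P i \<and> (\<forall>j. P j \<longrightarrow> i \<le> j)" if "\<exists>i. P i" for P :: "nat \<Rightarrow> bool"
      using that by (metis LeastI_ex Least_le)
  next
    fix f g :: "real \<Rightarrow> real"
    assume fg: "f \<in> carrier homeo_plus" "g \<in> carrier homeo_plus" "f \<noteq> g"
    show "\<exists>i. f (x i) \<noteq> g (x i)"
    proof (rule ccontr)
      assume "\<nexists>i. f (x i) \<noteq> g (x i)"
      then have eq: "range x \<subseteq> {y. f y = g y}" by auto
      have "continuous_on UNIV f" "continuous_on UNIV g"
        using fg unfolding homeo_plus_simps homeomorphism_def by auto
      then have "closed {y. f y = g y}"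
        by (rule closed_Collect_eq)
      then have "closure (range x) \<subseteq> {y. f y = g y}"
        using eq by (rule closure_minimal[rotated])
      then have "f y = g y" for y using dense by auto
      then show False using fg(3) by blast
    qed
  qed auto
qed

lemma general_dlos_subset_LO: "general_dlos \<subseteq> LO homeo_plus"
proof
  fix r assume "r \<in> general_dlos"
  then obtain w \<Omega> where r: "r = gen_dlo w \<Omega>" and w: "well_order_on UNIV w"
    unfolding general_dlos_def by blast
  have lin: "refl w" "trans w" "antisym w" "total w" and wf: "wf (w - Id)"
    using w unfolding well_order_on_def order_on_defs by auto
  show "r \<in> LO homeo_plus"
    unfolding r gen_dlo_def
  proof (rule left_ordering_dlo_aux[where le = "\<lambda>x y. (x, y) \<in> w" and p = "\<lambda>x. x"])
    fix P :: "real \<Rightarrow> bool" assume "\<exists>i. P i"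
    then obtain i where i: "P i" and min: "\<And>j. (j, i) \<in> w - Id \<Longrightarrow> \<not> P j"
      using wfE_min[OF wf, of _ "Collect P"] by (metis mem_Collect_eq)
    have "(i, j) \<in> w" if "P j" for j
      using that min[of j] lin by (cases "i = j") (auto simp: refl_on_def total_on_def)
    with i show "\<exists>i. P i \<and> (\<forall>j. P j \<longrightarrow> (i, j) \<in> w)" by blast
  qed (use lin in \<open>auto dest: antisymD transD\<close>)
qed

end

theory Submission
  imports Defs
begin

text \<open>
  Two distinct homeomorphisms \<open>f\<close> and \<open>g\<close> differ on a nonempty open set, and a dynamical-lexicographic
  ordering compares them at the first point of this set. Such an ordering is therefore governed by
  the map that sends a nonempty open set \<open>U\<close> to its first point, together with the sign attached to
  that point. First points are coherent: if the first point of \<open>U\<close> lies in a smaller open set \<open>V\<close>,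
  then it is also the first point of \<open>V\<close>. A sequence of left-orderings converges exactly when every
  comparison of two elements is eventually the one made by the limit (\<open>limitin_LO_iff\<close>).

  General orderings are limits of standard ones. By coherence, the first point of \<open>U\<close> is also the
  first point of a basic open set, so only a countable set \<open>D\<close> of points is ever consulted
  (\<open>countable_minima\<close>). This set is dense; enumerate it. The \<open>n\<close>-th approximating sequence lists the
  first \<open>n\<close> elements of \<open>D\<close> in the order of the given well-ordering and then all of \<open>D\<close>. Once the
  least point of \<open>U\<close> is among those \<open>n\<close> elements, it is the first listed point in \<open>U\<close>.

  Conversely, let standard orderings converge, and let \<open>p n\<close> be the first point of \<open>U\<close> in the \<open>n\<close>-th
  one. Testing the convergence on a homeomorphism that moves all of \<open>U\<close> upwards shows that the sign
  at \<open>p n\<close> is eventually constant. If \<open>p n\<close> itself were not, there would be two mutually separated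
  sets \<open>A\<close> and \<open>B\<close>, each visited infinitely often (\<open>eventually_constant_or_separated\<close>); a
  homeomorphism supported in \<open>U\<close> that moves \<open>A\<close> upwards and \<open>B\<close> downwards (\<open>homeo_separating\<close>)
  would then change its sign infinitely often. So first points converge to a choice of a point \<open>m U\<close>
  in each \<open>U\<close>. Coherence survives in the limit, and a coherent choice of points comes from a
  well-ordering (\<open>well_order_of_coherent_choice\<close>), which defines the limit ordering.
\<close>

section \<open>Convergence of left-orderings\<close>

lemma LO_D:
  assumes "r \<in> LO G"
  shows "refl_on (carrier G) r" "trans r" "antisym r" "total_on (carrier G) r"
    "r \<subseteq> carrier G \<times> carrier G"
  using assms unfolding LO_def left_ordering_def order_on_defs by auto

lemma LO_mult_left_iff:
  assumes G: "group G" and r: "r \<in> LO G"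
    and c: "f \<in> carrier G" "g \<in> carrier G" "h \<in> carrier G"
  shows "(h \<otimes>\<^bsub>G\<^esub> f, h \<otimes>\<^bsub>G\<^esub> g) \<in> r \<longleftrightarrow> (f, g) \<in> r"
proof -
  interpret group G by (fact G)
  have mono: "(k \<otimes>\<^bsub>G\<^esub> a, k \<otimes>\<^bsub>G\<^esub> b) \<in> r"
    if "(a, b) \<in> r" "a \<in> carrier G" "b \<in> carrier G" "k \<in> carrier G" for a b k
  proof (cases "a = b")
    case True
    then show ?thesis using that LO_D(1)[OF r] by (auto simp: refl_on_def)
  next
    case False
    then show ?thesis using that r unfolding LO_def left_ordering_def by blast
  qed
  have "(f, g) \<in> r" if "(h \<otimes>\<^bsub>G\<^esub> f, h \<otimes>\<^bsub>G\<^esub> g) \<in> r"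
  proof -
    have "(inv\<^bsub>G\<^esub> h \<otimes>\<^bsub>G\<^esub> (h \<otimes>\<^bsub>G\<^esub> f), inv\<^bsub>G\<^esub> h \<otimes>\<^bsub>G\<^esub> (h \<otimes>\<^bsub>G\<^esub> g)) \<in> r"
      using mono[OF that] c by simp
    then show ?thesis using c by (simp add: m_assoc[symmetric])
  qed
  then show ?thesis using mono c by blast
qed

lemma LO_pair_iff_positive:
  assumes G: "group G" and r: "r \<in> LO G" and c: "f \<in> carrier G" "g \<in> carrier G"
  shows "(\<one>\<^bsub>G\<^esub>, inv\<^bsub>G\<^esub> f \<otimes>\<^bsub>G\<^esub> g) \<in> r \<longleftrightarrow> (f, g) \<in> r"
proof -
  interpret group G by (fact G)
  show ?thesis using LO_mult_left_iff[OF G r c, of "inv\<^bsub>G\<^esub> f"] c by simp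
qed

lemma limitin_topology_generated_byI:
  assumes l: "l \<in> \<Union>\<B>"
    and ev: "\<And>b. b \<in> \<B> \<Longrightarrow> l \<in> b \<Longrightarrow> eventually (\<lambda>n. \<sigma> n \<in> b) F"
  shows "limitin (topology_generated_by \<B>) \<sigma> l F"
proof -
  have "l \<in> U \<longrightarrow> eventually (\<lambda>n. \<sigma> n \<in> U) F" if "generate_topology_on \<B> U" for U
    using that
  proof induction
    case (Int a b)
    then show ?case by (auto intro: eventually_conj)
  next
    case (UN K)
    show ?case
    proof
      assume "l \<in> \<Union>K"
      then obtain U where "U \<in> K" "l \<in> U" by blast
      then show "eventually (\<lambda>n. \<sigma> n \<in> \<Union>K) F"
        using UN.IH[of U] by (auto elim!: eventually_mono)
    qed
  qed (use ev in auto)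
  then show ?thesis
    using l unfolding limitin_def topology_generated_by_topspace
      openin_topology_generated_by_iff by blast
qed

text \<open>
  A subbasic set fixes the sign of finitely many elements, and by left-invariance the comparison of
  \<open>f\<close> with \<open>g\<close> is the sign of \<open>f\<inverse> g\<close>. So the topology only sees individual comparisons.
\<close>

lemma limitin_LO_iff:
  assumes G: "group G" and \<sigma>: "\<And>n. \<sigma> n \<in> LO G"
  shows "limitin (LO_topology G) \<sigma> l F \<longleftrightarrow>
    l \<in> LO G \<and> (\<forall>f g. (f, g) \<in> l \<longrightarrow> eventually (\<lambda>n. (f, g) \<in> \<sigma> n) F)"
    (is "?L \<longleftrightarrow> ?R")
proof
  interpret group G by (fact G)
  assume L: ?L
  then have l: "l \<in> LO G"
    unfolding limitin_def topspace_LO_topology by blast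
  have "eventually (\<lambda>n. (f, g) \<in> \<sigma> n) F" if fg: "(f, g) \<in> l" for f g
  proof (cases "f = g")
    case True
    have "f \<in> carrier G" using fg LO_D(5)[OF l] by blast
    then have "(f, g) \<in> \<sigma> n" for n
      using True LO_D(1)[OF \<sigma>] by (auto simp: refl_on_def)
    then show ?thesis by simp
  next
    case False
    have c: "f \<in> carrier G" "g \<in> carrier G" using fg LO_D(5)[OF l] by auto
    define h where "h = inv\<^bsub>G\<^esub> f \<otimes>\<^bsub>G\<^esub> g"
    have h: "h \<in> carrier G" "h \<noteq> \<one>\<^bsub>G\<^esub>"
      using c False unfolding h_def by (auto dest: inv_equality simp: inv_solve_left')
    have mem: "r \<in> LO_pos G {h} \<longleftrightarrow> (f, g) \<in> r" if "r \<in> LO G" for r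
      using that h LO_pair_iff_positive[OF G that c] unfolding LO_pos_def h_def by simp
    have "openin (LO_topology G) (LO_pos G {h})"
      unfolding LO_topology_def by (rule topology_generated_by_Basis) (use h in blast)
    then have "eventually (\<lambda>n. \<sigma> n \<in> LO_pos G {h}) F"
      using L mem[OF l] fg unfolding limitin_def by blast
    then show ?thesis using mem[OF \<sigma>] by simp
  qed
  with l show ?R by blast
next
  assume R: ?R
  show ?L
    unfolding LO_topology_def
  proof (rule limitin_topology_generated_byI)
    have "l \<in> LO_pos G {}" using R by (simp add: LO_pos_def)
    then show "l \<in> \<Union>{LO_pos G S |S. finite S \<and> S \<subseteq> carrier G}" by blast
  next
    fix b assume "b \<in> {LO_pos G S |S. finite S \<and> S \<subseteq> carrier G}" and l: "l \<in> b"
    then obtain S where b: "b = LO_pos G S" and S: "finite S" by blast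
    have "eventually (\<lambda>n. \<forall>s\<in>S. (\<one>\<^bsub>G\<^esub>, s) \<in> \<sigma> n) F"
      by (rule eventually_ball_finite[OF S]) (use R l in \<open>auto simp: b LO_pos_def\<close>)
    then show "eventually (\<lambda>n. \<sigma> n \<in> b) F"
      by (rule eventually_mono) (use \<sigma> l in \<open>auto simp: b LO_pos_def\<close>)
  qed
qed

text \<open>Totality turns a failing comparison into the reverse strict one, which also passes to the tail.\<close>

lemma limitin_LO_notin:
  assumes G: "group G" and \<sigma>: "\<And>n. \<sigma> n \<in> LO G" and lim: "limitin (LO_topology G) \<sigma> l F"
    and c: "f \<in> carrier G" "g \<in> carrier G" and fg: "(f, g) \<notin> l"
  shows "eventually (\<lambda>n. (f, g) \<notin> \<sigma> n) F"
proof -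
  have l: "l \<in> LO G" and ev: "\<And>f g. (f, g) \<in> l \<Longrightarrow> eventually (\<lambda>n. (f, g) \<in> \<sigma> n) F"
    using iffD1[OF limitin_LO_iff[OF G \<sigma>] lim] by simp_all
  have neq: "f \<noteq> g" using fg c LO_D(1)[OF l] by (auto simp: refl_on_def)
  then have "(g, f) \<in> l" using fg c LO_D(4)[OF l] by (auto simp: total_on_def)
  then show ?thesis
    by (rule eventually_mono[OF ev]) (use neq LO_D(3)[OF \<sigma>] in \<open>auto dest: antisymD\<close>)
qed

section \<open>Comparing two homeomorphisms at the first point where they differ\<close>

text \<open>The comparison of the values \<open>a = f x\<close> and \<open>b = g x\<close> when the sign \<open>s\<close> is attached to \<open>x\<close>.\<close>

definition exceeds :: "sign \<Rightarrow> real \<Rightarrow> real \<Rightarrow> bool" where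
  "exceeds s a b \<longleftrightarrow> a > b \<and> s = Plus \<or> a < b \<and> s = Minus"

text \<open>
  The index rather than the point itself: a sequence may repeat points, and the sign depends on
  the index at which a point is met first.
\<close>

definition first_in :: "(nat \<Rightarrow> 'a) \<Rightarrow> 'a set \<Rightarrow> nat" where
  "first_in x U = (LEAST k. x k \<in> U)"

lemma first_in_mem:
  fixes x :: "nat \<Rightarrow> 'a::topological_space"
  assumes "closure (range x) = UNIV" "open U" "U \<noteq> {}"
  shows "x (first_in x U) \<in> U"
proof -
  have "\<exists>k. x k \<in> U"
    using assms open_Int_closure_eq_empty[OF assms(2), of "range x"] by auto
  then show ?thesis unfolding first_in_def by (rule LeastI_ex)
qed

lemma first_in_le: "x k \<in> U \<Longrightarrow> first_in x U \<le> k"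
  unfolding first_in_def by (rule Least_le)

text \<open>
  Coherence of first points. Equality of the indices also gives equality of the attached signs.
\<close>

lemma first_in_subset:
  assumes "V \<subseteq> U" "x (first_in x U) \<in> V"
  shows "first_in x V = first_in x U"
proof (rule antisym)
  show "first_in x V \<le> first_in x U" using assms(2) by (rule first_in_le)
  have "x (first_in x V) \<in> V"
    using assms(2) unfolding first_in_def[of x V] by (rule LeastI)
  then show "first_in x U \<le> first_in x V" using assms(1) by (auto intro: first_in_le)
qed

lemma open_differ:
  assumes "f \<in> carrier homeo_plus" "g \<in> carrier homeo_plus"
  shows "open {y. f y \<noteq> g y}"
  by (rule open_Collect_neq) (use assms in \<open>auto simp: homeo_plus_simps homeomorphism_def\<close>)

lemma std_dlo_iff:
  assumes x: "closure (range x) = UNIV"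
    and c: "f \<in> carrier homeo_plus" "g \<in> carrier homeo_plus" and neq: "f \<noteq> g"
  defines "k \<equiv> first_in x {y. f y \<noteq> g y}"
  shows "(g, f) \<in> std_dlo x \<Omega> \<longleftrightarrow> exceeds (\<Omega> k) (f (x k)) (g (x k))"
proof -
  have "{y. f y \<noteq> g y} \<noteq> {}" using neq by auto
  from first_in_mem[OF x open_differ[OF c] this]
  have k: "f (x k) \<noteq> g (x k)" unfolding k_def by simp
  have min: "k \<le> m" if "f (x m) \<noteq> g (x m)" for m
    unfolding k_def by (rule first_in_le) (use that in simp)
  have "n = k" if "f (x n) \<noteq> g (x n)" "\<forall>m. f (x m) \<noteq> g (x m) \<longrightarrow> n \<le> m" for n
    using that k min by (meson le_antisym)
  then show ?thesis
    using k min c neq unfolding std_dlo_def exceeds_def by blast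
qed

lemma gen_dlo_iff:
  assumes w: "well_order_on UNIV w"
    and c: "f \<in> carrier homeo_plus" "g \<in> carrier homeo_plus"
    and m: "f m \<noteq> g m" and min: "\<And>y. f y \<noteq> g y \<Longrightarrow> (m, y) \<in> w"
  shows "(g, f) \<in> gen_dlo w \<Omega> \<longleftrightarrow> exceeds (\<Omega> m) (f m) (g m)"
proof -
  have "antisym w" using w unfolding order_on_defs by auto
  then have "x = m" if "f x \<noteq> g x" "\<forall>y. f y \<noteq> g y \<longrightarrow> (x, y) \<in> w" for x
    using that m min by (meson antisymD)
  moreover have "f \<noteq> g" using m by auto
  ultimately show ?thesis
    using m min c unfolding gen_dlo_def exceeds_def by blast
qed

section \<open>Well-orders\<close>

lemma well_order_on_UNIV_least:
  assumes w: "well_order_on UNIV w" and E: "E \<noteq> {}"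
  shows "\<exists>e\<in>E. \<forall>y\<in>E. (e, y) \<in> w"
proof -
  have lin: "refl w" "total w" and wf: "wf (w - Id)"
    using w unfolding well_order_on_def order_on_defs by auto
  obtain e where e: "e \<in> E" and min: "\<And>y. (y, e) \<in> w - Id \<Longrightarrow> y \<notin> E"
    using wfE_min[OF wf, of _ E] E by blast
  have "(e, y) \<in> w" if "y \<in> E" for y
    using that min[of y] lin by (cases "e = y") (auto simp: refl_on_def total_on_def)
  with e show ?thesis by blast
qed

text \<open>
  Totality and transitivity come for free, from the least elements of sets with two or three
  members.
\<close>

lemma well_order_on_UNIV_I:
  assumes anti: "antisym w"
    and least: "\<And>E. E \<noteq> {} \<Longrightarrow> \<exists>e\<in>E. \<forall>y\<in>E. (e, y) \<in> w"
  shows "well_order_on UNIV w"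
proof -
  have refl: "(a, a) \<in> w" for a using least[of "{a}"] by simp
  have tot: "(a, b) \<in> w \<or> (b, a) \<in> w" for a b using least[of "{a, b}"] by auto
  have trans: "(a, c) \<in> w" if "(a, b) \<in> w" "(b, c) \<in> w" for a b c
    using least[of "{a, b, c}"] that antisymD[OF anti] by blast
  have "wf (w - Id)"
  proof (rule wfI_min)
    fix x and Q :: "'a set" assume "x \<in> Q"
    then obtain e where "e \<in> Q" "\<forall>y\<in>Q. (e, y) \<in> w" using least[of Q] by blast
    then show "\<exists>z\<in>Q. \<forall>y. (y, z) \<in> w - Id \<longrightarrow> y \<notin> Q"
      using antisymD[OF anti] by blast
  qed
  moreover have "refl w" using refl by (simp add: refl_on_def)
  moreover have "trans w" using trans by (rule transI)
  moreover have "total w" using tot by (simp add: total_on_def)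
  ultimately show ?thesis using anti unfolding well_order_on_def order_on_defs by simp
qed

text \<open>
  Put \<open>m U\<close> below every point of \<open>U\<close>. Coherence on intersections makes this antisymmetric. A set \<open>E\<close>
  of chosen points has a least element: if \<open>W\<close> is the union of all \<open>U\<close> with \<open>m U \<in> E\<close>, then \<open>m W\<close> lies
  in one of these \<open>U\<close>, so it equals \<open>m U\<close> by coherence and belongs to \<open>E\<close>, while \<open>E \<subseteq> W\<close>. Points
  that are never chosen are put on top, in an arbitrary well-ordering.
\<close>

lemma well_order_of_coherent_choice:
  fixes m :: "'a::topological_space set \<Rightarrow> 'a"
  assumes mem: "\<And>U. open U \<Longrightarrow> U \<noteq> {} \<Longrightarrow> m U \<in> U"
    and coh: "\<And>U V. open U \<Longrightarrow> open V \<Longrightarrow> V \<subseteq> U \<Longrightarrow> m U \<in> V \<Longrightarrow> m V = m U"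
  obtains w where "well_order_on UNIV w" "\<And>U y. open U \<Longrightarrow> y \<in> U \<Longrightarrow> (m U, y) \<in> w"
proof -
  define D where "D = m ` {U. open U \<and> U \<noteq> {}}"
  obtain R :: "'a rel" where R: "well_order_on UNIV R" using well_order_on by blast
  define w1 where "w1 = {(m U, y) | U y. open U \<and> y \<in> U}"
  define w where "w = w1 \<union> {(a, b). b \<notin> D \<and> (a \<in> D \<or> (a, b) \<in> R)}"
  have w1_D: "a \<in> D" if "(a, b) \<in> w1" for a b
    using that unfolding w1_def D_def by blast
  have anti1: "a = b" if "(a, b) \<in> w1" "(b, a) \<in> w1" for a b
  proof -
    have "\<exists>U. open U \<and> b \<in> U \<and> a = m U" using that(1) unfolding w1_def by auto
    then obtain U where U: "open U" "b \<in> U" "a = m U" by blast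
    have "\<exists>V. open V \<and> a \<in> V \<and> b = m V" using that(2) unfolding w1_def by auto
    then obtain V where V: "open V" "a \<in> V" "b = m V" by blast
    have "m U \<in> U \<inter> V" "m V \<in> U \<inter> V"
      using U V mem[of U] mem[of V] by auto
    then have "m (U \<inter> V) = m U" "m (U \<inter> V) = m V"
      using coh[of U "U \<inter> V"] coh[of V "U \<inter> V"] open_Int[OF U(1) V(1)] U V by auto
    then show ?thesis using U V by simp
  qed
  have antiR: "antisym R" using R unfolding order_on_defs by blast
  have "antisym w"
  proof (rule antisymI)
    fix a b assume "(a, b) \<in> w" "(b, a) \<in> w"
    then consider "(a, b) \<in> w1" "(b, a) \<in> w1" | "(a, b) \<in> R" "(b, a) \<in> R"
      using w1_D unfolding w_def by auto
    then show "a = b" by cases (use anti1 antisymD[OF antiR] in \<open>simp_all\<close>)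
  qed
  moreover have "\<exists>e\<in>E. \<forall>y\<in>E. (e, y) \<in> w" if E: "E \<noteq> {}" for E
  proof (cases "E \<inter> D = {}")
    case True
    obtain e where "e \<in> E" "\<forall>y\<in>E. (e, y) \<in> R" using well_order_on_UNIV_least[OF R E] by blast
    then show ?thesis using True unfolding w_def by (intro bexI[of _ e]) auto
  next
    case False
    define W where "W = \<Union>{U. open U \<and> U \<noteq> {} \<and> m U \<in> E}"
    have W: "open W" "E \<inter> D \<subseteq> W" unfolding W_def D_def using mem by (auto intro: open_Union)
    then have "m W \<in> W" using mem[of W] False by auto
    then obtain U where U: "open U" "m U \<in> E" "m W \<in> U" "U \<subseteq> W" unfolding W_def by blast
    then have "m W = m U" using coh[OF W(1) U(1,4,3)] by simp
    then have "m W \<in> E" "m W \<in> D" using U unfolding D_def by auto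
    moreover have "(m W, y) \<in> w" if "y \<in> E" for y
      using that W \<open>m W \<in> D\<close> unfolding w_def w1_def by (cases "y \<in> D") auto
    ultimately show ?thesis by blast
  qed
  ultimately have "well_order_on UNIV w" by (rule well_order_on_UNIV_I)
  moreover have "(m U, y) \<in> w" if "open U" "y \<in> U" for U y
    using that unfolding w_def w1_def by blast
  ultimately show ?thesis by (rule that)
qed

lemma sorted_list_of_finite_set:
  assumes w: "well_order_on UNIV w" and F: "finite F"
  shows "\<exists>xs. set xs = F \<and> sorted_wrt (\<lambda>a b. (a, b) \<in> w) xs"
  using F
proof (induction rule: finite_psubset_induct)
  case (psubset F)
  show ?case
  proof (cases "F = {}")
    case True
    then show ?thesis by (intro exI[of _ "[]"]) simp
  next
    case False
    then obtain e where e: "e \<in> F" "\<forall>y\<in>F. (e, y) \<in> w"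
      using well_order_on_UNIV_least[OF w] by blast
    then obtain xs where "set xs = F - {e}" "sorted_wrt (\<lambda>a b. (a, b) \<in> w) xs"
      using psubset.IH[of "F - {e}"] by blast
    then show ?thesis using e by (intro exI[of _ "e # xs"]) auto
  qed
qed

section \<open>General orderings are limits of standard ones\<close>

text \<open>
  If \<open>V\<close> is a basic open set with \<open>m U \<in> V \<subseteq> U\<close>, where \<open>m\<close> takes minima, then \<open>m V = m U\<close>. Hence the
  minima of the members of a countable basis are all the minima.
\<close>

lemma countable_minima:
  fixes w :: "'a::second_countable_topology rel"
  assumes w: "well_order_on UNIV w"
  obtains D where "countable D"
    "\<And>U. open U \<Longrightarrow> U \<noteq> {} \<Longrightarrow> \<exists>d\<in>D \<inter> U. \<forall>y\<in>U. (d, y) \<in> w"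
proof -
  obtain B :: "'a set set" where B: "countable B" "topological_basis B"
    using ex_countable_basis by blast
  define m where "m U = (SOME e. e \<in> U \<and> (\<forall>y\<in>U. (e, y) \<in> w))" for U
  have m: "m U \<in> U" "\<And>y. y \<in> U \<Longrightarrow> (m U, y) \<in> w" if "U \<noteq> {}" for U
    using someI_ex[of "\<lambda>e. e \<in> U \<and> (\<forall>y\<in>U. (e, y) \<in> w)"]
      well_order_on_UNIV_least[OF w that] unfolding m_def by blast+
  have anti: "antisym w" using w unfolding order_on_defs by blast
  have "\<exists>d\<in>(m ` B) \<inter> U. \<forall>y\<in>U. (d, y) \<in> w" if U: "open U" "U \<noteq> {}" for U
  proof -
    obtain V where V: "V \<in> B" "m U \<in> V" "V \<subseteq> U"
      using topological_basisE[OF B(2) U(1) m(1)[OF U(2)]] by blast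
    then have "m V = m U"
      using m[of V] m[of U] U(2) antisymD[OF anti, of "m V" "m U"] by blast
    then show ?thesis using V m[of U] U(2) by (intro bexI[of _ "m U"]) (auto intro: rev_image_eqI)
  qed
  moreover have "countable (m ` B)" using B(1) by blast
  ultimately show ?thesis using that by blast
qed

text \<open>
  A standard ordering inspects points in order type \<open>\<omega>\<close>, whereas the well-ordering restricted to the
  minima may have any countable order type. Sorting longer and longer finite sets of minima bridges
  the gap.
\<close>

lemma general_dlo_in_seq_closure:
  assumes w: "well_order_on UNIV w"
  shows "gen_dlo w \<Omega> \<in> seq_closure (LO_topology homeo_plus) standard_dlos"
proof -
  obtain D where D: "countable D"
    "\<And>U. open U \<Longrightarrow> U \<noteq> {} \<Longrightarrow> \<exists>d\<in>D \<inter> U. \<forall>y\<in>U. (d, y) \<in> w"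
    using countable_minima[OF w] by blast
  have "D \<noteq> {}" using D(2)[of UNIV] by auto
  define d where "d = from_nat_into D"
  have d: "range d = D" unfolding d_def using \<open>D \<noteq> {}\<close> D(1) by (rule range_from_nat_into)
  have "\<exists>xs. \<forall>n. set (xs n) = d ` {..<n} \<and> sorted_wrt (\<lambda>a b. (a, b) \<in> w) (xs n)"
    using sorted_list_of_finite_set[OF w] by (intro choice allI) simp
  then obtain xs where set_xs: "\<And>n. set (xs n) = d ` {..<n}"
    and sorted: "\<And>n. sorted_wrt (\<lambda>a b. (a, b) \<in> w) (xs n)" by blast
  \<comment> \<open>The tail repeats all of \<open>D\<close>, which makes every \<open>x n\<close> dense.\<close>
  define x where "x n k = (if k < length (xs n) then xs n ! k else d (k - length (xs n)))" for n k
  have "d i \<in> range (x n)" for n i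
    by (rule range_eqI[of _ _ "length (xs n) + i"]) (simp add: x_def)
  then have sub: "D \<subseteq> range (x n)" for n using d by blast
  have dense: "closure (range (x n)) = UNIV" for n
  proof -
    have "open (- closure (range (x n)))" by (intro open_Compl closed_closure)
    then have "- closure (range (x n)) = {}"
      using D(2)[of "- closure (range (x n))"] sub[of n] closure_subset[of "range (x n)"] by blast
    then show ?thesis by blast
  qed
  have anti: "antisym w" using w unfolding order_on_defs by blast
  define \<sigma> where "\<sigma> n = std_dlo (x n) (\<lambda>k. \<Omega> (x n k))" for n
  have \<sigma>: "\<sigma> n \<in> standard_dlos" for n
    unfolding \<sigma>_def standard_dlos_def using dense by blast
  have gen: "gen_dlo w \<Omega> \<in> LO homeo_plus"
    using w general_dlos_subset_LO unfolding general_dlos_def by blast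
  have "eventually (\<lambda>n. (g, f) \<in> \<sigma> n) sequentially" if gf: "(g, f) \<in> gen_dlo w \<Omega>" for f g
  proof (cases "f = g")
    case True
    then show ?thesis using gf unfolding \<sigma>_def std_dlo_def gen_dlo_def by simp
  next
    case False
    have c: "f \<in> carrier homeo_plus" "g \<in> carrier homeo_plus" using gf unfolding gen_dlo_def by auto
    define U where "U = {y. f y \<noteq> g y}"
    have "open U" "U \<noteq> {}" unfolding U_def using open_differ[OF c] False by auto
    then obtain m where m: "m \<in> D" "m \<in> U" "\<And>y. y \<in> U \<Longrightarrow> (m, y) \<in> w" using D(2)[of U] by auto
    obtain j where j: "m = d j" using m(1) d by blast
    have ex: "exceeds (\<Omega> m) (f m) (g m)"
      using gen_dlo_iff[OF w c, of m \<Omega>] m gf unfolding U_def by simp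
    have "(g, f) \<in> \<sigma> n" if n: "n > j" for n
    proof -
      define k where "k = first_in (x n) U"
      have kU: "x n k \<in> U" unfolding k_def
        by (rule first_in_mem) (use dense \<open>open U\<close> \<open>U \<noteq> {}\<close> in auto)
      \<comment> \<open>The minimum \<open>m\<close> of \<open>U\<close> is already listed, and everything listed before it is smaller,
        hence outside \<open>U\<close>.\<close>
      have "m \<in> set (xs n)" using set_xs j n by auto
      then obtain i where i: "i < length (xs n)" "xs n ! i = m" by (auto simp: in_set_conv_nth)
      have "k \<le> i" unfolding k_def by (rule first_in_le) (use i m(2) in \<open>simp add: x_def\<close>)
      then have "x n k = m \<or> (x n k, m) \<in> w"
        using i sorted_wrt_nth_less[OF sorted, of k i n] by (cases "k = i") (auto simp: x_def)
      then have "x n k = m" using m(3)[OF kU] antisymD[OF anti] by blast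
      then show ?thesis
        using ex std_dlo_iff[OF dense c False, of n] unfolding \<sigma>_def k_def U_def by simp
    qed
    then show ?thesis by (rule eventually_mono[OF eventually_gt_at_top[of j]])
  qed
  then have "limitin (LO_topology homeo_plus) \<sigma> (gen_dlo w \<Omega>) sequentially"
    using limitin_LO_iff[OF group_homeo_plus, of \<sigma>] \<sigma> standard_dlos_subset_LO gen by blast
  then show ?thesis unfolding seq_closure_def using \<sigma> by blast
qed

section \<open>Test homeomorphisms\<close>

text \<open>
  Perturbing the identity by a function with Lipschitz constant less than one stretches distances by
  factors bounded away from zero; this gives surjectivity and a continuous inverse at once. All test
  homeomorphisms below are of this form, so that no gluing of bumps is required.
\<close>

lemma homeo_plus_id_plus_Lipschitz:
  fixes \<phi> :: "real \<Rightarrow> real"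
  assumes lip: "\<And>x y. \<bar>\<phi> x - \<phi> y\<bar> \<le> \<bar>x - y\<bar> / 2"
  shows "(\<lambda>x. x + \<phi> x) \<in> carrier homeo_plus"
proof -
  define f where "f x = x + \<phi> x" for x
  have expand: "f y - f x \<ge> (y - x) / 2" if "x \<le> y" for x y
    using lip[of y x] that unfolding f_def by (auto simp: abs_if split: if_splits)
  have "strict_mono f"
  proof (rule strict_monoI)
    fix x y :: real assume "x < y"
    then show "f x < f y" using expand[of x y] by simp
  qed
  have "(1/2)-lipschitz_on UNIV \<phi>"
    by (rule lipschitz_onI) (use lip in \<open>auto simp: dist_real_def\<close>)
  then have cont: "continuous_on UNIV f"
    unfolding f_def by (intro continuous_intros lipschitz_on_continuous_on)
  have surj: "\<exists>x. f x = y" for y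
  proof -
    define c where "c = 2 * \<bar>y - f 0\<bar>"
    have "f (- c) \<le> y" "y \<le> f c"
      using expand[of "- c" 0] expand[of 0 c] unfolding c_def by auto
    moreover have "- c \<le> c" unfolding c_def by simp
    ultimately show ?thesis
      using IVT'[of f "- c" y c] continuous_on_subset[OF cont] by blast
  qed
  have inj: "inj f" using \<open>strict_mono f\<close> by (rule strict_mono_imp_inj_on)
  define g where "g = inv_into UNIV f"
  have g: "f (g a) = a" for a
    unfolding g_def using surj[of a] by (auto intro: f_inv_into_f)
  have gf: "g (f a) = a" for a
    unfolding g_def using inj by simp
  have "continuous_on UNIV g"
  proof -
    have "2-lipschitz_on UNIV g"
    proof (rule lipschitz_onI)
      fix a b :: real
      show "dist (g a) (g b) \<le> 2 * dist a b"
        using expand[of "g a" "g b"] expand[of "g b" "g a"] g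
        by (cases "g a \<le> g b") (auto simp: dist_real_def)
    qed simp
    then show ?thesis by (rule lipschitz_on_continuous_on)
  qed
  then have "homeomorphism UNIV UNIV f g"
    using cont g gf by (intro homeomorphismI) auto
  then have "f \<in> carrier homeo_plus" unfolding homeo_plus_simps using \<open>strict_mono f\<close> by blast
  then show ?thesis unfolding f_def .
qed

lemma infdist_Lipschitz: "\<bar>infdist x A - infdist y A\<bar> \<le> dist x y"
  using infdist_triangle[of x A y] infdist_triangle[of y A x] by (simp add: dist_commute)

text \<open>
  The displacement is half the distance to the complement of \<open>U\<close>. The whole line is separate, because
  \<open>infdist\<close> to the empty set is zero.
\<close>

lemma homeo_above_id_on:
  fixes U :: "real set"
  assumes U: "open U"
  obtains f where "f \<in> carrier homeo_plus" "{y. f y \<noteq> y} = U" "\<And>y. y \<in> U \<Longrightarrow> f y > y"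
proof (cases "U = UNIV")
  case True
  have "(\<lambda>y. y + 1) \<in> carrier homeo_plus"
    by (rule homeo_plus_id_plus_Lipschitz) simp
  then show ?thesis by (rule that) (use True in auto)
next
  case False
  define \<phi> where "\<phi> y = infdist y (- U) / 2" for y
  have "closed (- U)" "- U \<noteq> {}" using U False by auto
  then have pos: "\<phi> y > 0" if "y \<in> U" for y
    using that infdist_pos_not_in_closed[of "- U" y] unfolding \<phi>_def by simp
  moreover have "\<phi> y = 0" if "y \<notin> U" for y using that unfolding \<phi>_def by simp
  ultimately have "{y. y + \<phi> y \<noteq> y} = U" by force
  moreover have "(\<lambda>y. y + \<phi> y) \<in> carrier homeo_plus"
    by (rule homeo_plus_id_plus_Lipschitz)
      (use infdist_Lipschitz[of _ "- U"] in \<open>auto simp: \<phi>_def dist_real_def diff_divide_distrib[symmetric]\<close>)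
  ultimately show ?thesis using pos by (intro that) auto
qed

text \<open>
  The displacement is a quarter of the distance to \<open>- U \<union> B\<close> minus the distance to \<open>- U \<union> A\<close>. Outside
  \<open>U\<close> both distances vanish; on \<open>A\<close> only the second does, because \<open>A\<close> avoids the closure of \<open>- U \<union> B\<close>,
  and symmetrically on \<open>B\<close>. The factor keeps the Lipschitz constant of the difference at one half.
\<close>

lemma homeo_separating:
  fixes U A B :: "real set"
  assumes U: "open U" and A: "A \<subseteq> U" "A \<noteq> {}" and B: "B \<subseteq> U" "B \<noteq> {}"
    and sep: "A \<inter> closure B = {}" "B \<inter> closure A = {}"
  obtains f where "f \<in> carrier homeo_plus" "{y. f y \<noteq> y} \<subseteq> U"
    "\<And>a. a \<in> A \<Longrightarrow> f a > a" "\<And>b. b \<in> B \<Longrightarrow> f b < b"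
proof -
  define \<phi> where "\<phi> y = (infdist y (- U \<union> B) - infdist y (- U \<union> A)) / 4" for y
  have cl: "closure (- U \<union> C) = - U \<union> closure C" for C
    using U by (simp add: closure_Un closure_complement interior_open)
  have pos: "infdist y (- U \<union> C) > 0" if "y \<in> U" "y \<notin> closure C" "C \<noteq> {}" for y C
    using that in_closure_iff_infdist_zero[of "- U \<union> C" y, unfolded cl]
      infdist_nonneg[of y "- U \<union> C"] by (auto simp: less_le)
  have zero: "\<phi> y = 0" if "y \<notin> U" for y using that unfolding \<phi>_def by simp
  have "\<phi> a > 0" if "a \<in> A" for a
    using that pos[of a B] A B sep unfolding \<phi>_def by auto
  moreover have "\<phi> b < 0" if "b \<in> B" for b
    using that pos[of b A] A B sep unfolding \<phi>_def by auto
  moreover have "(\<lambda>y. y + \<phi> y) \<in> carrier homeo_plus"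
  proof (rule homeo_plus_id_plus_Lipschitz)
    show "\<bar>\<phi> x - \<phi> y\<bar> \<le> \<bar>x - y\<bar> / 2" for x y
      using infdist_Lipschitz[of x "- U \<union> B" y] infdist_Lipschitz[of x "- U \<union> A" y]
      unfolding \<phi>_def dist_real_def by (simp add: abs_le_iff)  argo
  qed
  moreover have "{y. y + \<phi> y \<noteq> y} \<subseteq> U" using zero by force
  ultimately show ?thesis by (intro that) auto
qed

section \<open>Limits of standard orderings are general\<close>

text \<open>The terms next to \<open>q k\<close> bound an open interval that contains no other term.\<close>

lemma strict_monotone_not_in_closure:
  fixes q :: "nat \<Rightarrow> real"
  assumes "strict_mono q" "k \<notin> S"
  shows "q k \<notin> closure (q ` S)"
proof -
  define V where "V = {..<q (Suc k)} \<inter> (if k = 0 then UNIV else {q (k - 1)<..})"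
  have q_less: "q i < q j \<longleftrightarrow> i < j" for i j using assms(1) by (rule strict_mono_less)
  have "open V" unfolding V_def by auto
  moreover have "q k \<in> V" unfolding V_def by (auto simp: q_less)
  moreover have "j = k" if "q j \<in> V" for j
    using that unfolding V_def by (auto simp: q_less split: if_splits)
  then have "V \<inter> q ` S = {}" using assms(2) by blast
  ultimately show ?thesis using open_Int_closure_eq_empty by blast
qed

text \<open>
  An infinite set contains a strictly monotone sequence; its even and its odd terms are separated,
  no matter whether the sequence converges.
\<close>

lemma infinite_separated_subsets:
  fixes R :: "real set"
  assumes "infinite R"
  obtains A B where "A \<subseteq> R" "B \<subseteq> R" "infinite A" "infinite B"
    "A \<inter> closure B = {}" "B \<inter> closure A = {}"
proof -
  obtain p :: "nat \<Rightarrow> real" where p: "inj p" "range p \<subseteq> R"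
    using infinite_countable_subset[OF assms] by blast
  obtain h :: "nat \<Rightarrow> nat" where h: "strict_mono h" "monoseq (\<lambda>n. p (h n))"
    using seq_monosub by blast
  define q where "q n = p (h n)" for n
  have inj: "inj q" unfolding q_def 
    using inj_compose[OF p(1) strict_mono_imp_inj_on[OF h(1)]] by (simp add: o_def)
  have q: "range q \<subseteq> R" unfolding q_def using p(2) by blast
  have disj: "q k \<notin> closure (q ` S)" if "k \<notin> S" for k S
    using h(2) unfolding monoseq_def q_def[symmetric]
  proof
    assume "\<forall>m. \<forall>n\<ge>m. q m \<le> q n"
    then have "strict_mono q"
      using inj by (intro strict_monoI) (simp add: inj_eq less_le)
    then show ?thesis using that by (rule strict_monotone_not_in_closure)
  next
    assume "\<forall>m. \<forall>n\<ge>m. q n \<le> q m"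
    then have "strict_mono (\<lambda>n. - q n)"
      using inj by (intro strict_monoI) (simp add: inj_eq less_le)
    then have "- q k \<notin> closure ((\<lambda>n. - q n) ` S)"
      using that by (rule strict_monotone_not_in_closure)
    moreover have "uminus ` closure (q ` S) \<subseteq> closure ((\<lambda>n. - q n) ` S)"
      by (rule image_closure_subset)
        (auto intro!: continuous_intros closure_subset[THEN subsetD])
    ultimately show ?thesis by blast
  qed
  have inf: "infinite (q ` S)" if "infinite S" for S
    using that inj by (meson finite_imageD inj_on_subset subset_UNIV)
  have "\<exists>n\<ge>m. even n" "\<exists>n\<ge>m. odd n" for m :: nat
    by (rule exI[of _ "2 * m"], simp) (rule exI[of _ "2 * m + 1"], simp)
  then have inf_even: "infinite {n::nat. even n}" "infinite {n::nat. odd n}"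
    by (simp_all add: infinite_nat_iff_unbounded_le)
  show ?thesis
  proof (rule that[of "q ` {n. even n}" "q ` {n. odd n}"])
    show "q ` {n. even n} \<inter> closure (q ` {n. odd n}) = {}"
      "q ` {n. odd n} \<inter> closure (q ` {n. even n}) = {}"
      using disj by auto
  qed (use q inf inf_even in auto)
qed

text \<open>
  If infinitely many values occur, separated infinite sets of values are each visited infinitely
  often. Otherwise two single values are. The distinction has to be made by the number of values: a
  value \<open>a\<close> taken infinitely often cannot serve as \<open>A\<close> if the remaining values converge to \<open>a\<close>.
\<close>

lemma eventually_constant_or_separated:
  fixes p :: "nat \<Rightarrow> real"
  assumes nc: "\<nexists>a. eventually (\<lambda>n. p n = a) sequentially"
  obtains A B where "A \<subseteq> range p" "B \<subseteq> range p" "A \<inter> closure B = {}" "B \<inter> closure A = {}"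
    "frequently (\<lambda>n. p n \<in> A) sequentially" "frequently (\<lambda>n. p n \<in> B) sequentially"
proof (cases "finite (range p)")
  case False
  then obtain A B where AB: "A \<subseteq> range p" "B \<subseteq> range p" "infinite A" "infinite B"
    "A \<inter> closure B = {}" "B \<inter> closure A = {}" by (rule infinite_separated_subsets)
  have "frequently (\<lambda>n. p n \<in> C) sequentially" if C: "C \<subseteq> range p" "infinite C" for C
  proof -
    have "C \<subseteq> p ` {n. p n \<in> C}" using C(1) by blast
    then have "infinite {n. p n \<in> C}" using C(2) by (meson finite_imageI finite_subset)
    then show ?thesis unfolding cofinite_eq_sequentially[symmetric] by (simp add: frequently_cofinite)
  qed
  from that[OF AB(1,2,5,6)] this AB show ?thesis by simp
next
  case True
  have freq: "\<exists>a\<in>C. frequently (\<lambda>n. p n = a) sequentially"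
    if "frequently (\<lambda>n. p n \<in> C) sequentially" "finite C" for C
    using that frequently_bex_finite[of C "\<lambda>n a. p n = a" sequentially]
    by (simp add: frequently_def)
  have "frequently (\<lambda>n. p n \<in> range p) sequentially" by (simp add: frequently_def)
  then obtain a where a: "a \<in> range p" "frequently (\<lambda>n. p n = a) sequentially"
    using freq True by blast
  have "frequently (\<lambda>n. p n \<noteq> a) sequentially" using nc by (simp add: frequently_def)
  then have "frequently (\<lambda>n. p n \<in> range p - {a}) sequentially" by simp
  then obtain b where b: "b \<in> range p - {a}" "frequently (\<lambda>n. p n = b) sequentially"
    using freq True by blast
  show ?thesis by (rule that[of "{a}" "{b}"]) (use a b in auto)
qed

text \<open>
  The pairs of a first point and its sign stabilise on every nonempty open set, and the limits of
  these pairs supply the well-ordering and the sign function of the limit ordering.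
\<close>

lemma seq_closure_standard_general:
  assumes "l \<in> seq_closure (LO_topology homeo_plus) standard_dlos"
  shows "l \<in> general_dlos"
proof -
  obtain \<sigma> :: "nat \<Rightarrow> (real \<Rightarrow> real) rel" where \<sigma>: "range \<sigma> \<subseteq> standard_dlos"
    and lim: "limitin (LO_topology homeo_plus) \<sigma> l sequentially"
    using assms unfolding seq_closure_def by blast
  have "\<forall>n. \<exists>x \<Omega>. \<sigma> n = std_dlo x \<Omega> \<and> closure (range x) = UNIV"
    using \<sigma> unfolding standard_dlos_def by blast
  then obtain x \<Omega> where \<sigma>_eq: "\<And>n. \<sigma> n = std_dlo (x n) (\<Omega> n)"
    and dense: "\<And>n. closure (range (x n)) = UNIV" by metis
  have \<sigma>_LO: "\<sigma> n \<in> LO homeo_plus" for n using \<sigma> standard_dlos_subset_LO by blast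
  have l: "l \<in> LO homeo_plus"
    and lim_in: "\<And>f g. (f, g) \<in> l \<Longrightarrow> eventually (\<lambda>n. (f, g) \<in> \<sigma> n) sequentially"
    using iffD1[OF limitin_LO_iff[OF group_homeo_plus \<sigma>_LO] lim] by simp_all
  note lim_notin = limitin_LO_notin[OF group_homeo_plus \<sigma>_LO lim]
  define k where "k n U = first_in (x n) U" for n U
  define p where "p U n = x n (k n U)" for U n
  define s where "s U n = \<Omega> n (k n U)" for U n
  have p_mem: "p U n \<in> U" if "open U" "U \<noteq> {}" for U n
    unfolding p_def k_def using dense that by (rule first_in_mem)
  have k_sub: "k n V = k n U" if "V \<subseteq> U" "p U n \<in> V" for U V n
    using that unfolding p_def k_def by (rule first_in_subset)
  have \<sigma>_iff: "(g, f) \<in> \<sigma> n \<longleftrightarrow>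
      exceeds (s {y. f y \<noteq> g y} n) (f (p {y. f y \<noteq> g y} n)) (g (p {y. f y \<noteq> g y} n))"
    if "f \<in> carrier homeo_plus" "g \<in> carrier homeo_plus" "f \<noteq> g" for f g n
    using std_dlo_iff[OF dense that, of n] unfolding \<sigma>_eq s_def p_def k_def by blast
  have id_c: "id \<in> carrier homeo_plus"
    using group.is_monoid[OF group_homeo_plus] monoid.one_closed[of homeo_plus]
    by (metis homeo_plus_simps(3))

  \<comment> \<open>Signs stabilise: a homeomorphism moving all of \<open>U\<close> upwards is positive exactly when the sign
    is \<open>Plus\<close>, whatever the first point of \<open>U\<close> is.\<close>
  have s_const: "\<exists>c. eventually (\<lambda>n. s U n = c) sequentially" if U: "open U" "U \<noteq> {}" for U
  proof -
    obtain f where f: "f \<in> carrier homeo_plus" "{y. f y \<noteq> y} = U" "\<And>y. y \<in> U \<Longrightarrow> f y > y"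
      using homeo_above_id_on[OF U(1)] by blast
    have "f \<noteq> id" using f(2) U(2) by auto
    have iff: "(id, f) \<in> \<sigma> n \<longleftrightarrow> s U n = Plus" for n
    proof -
      have "(id, f) \<in> \<sigma> n \<longleftrightarrow> exceeds (s U n) (f (p U n)) (p U n)"
        using \<sigma>_iff[OF f(1) id_c \<open>f \<noteq> id\<close>, of n] f(2) by simp
      then show ?thesis using f(3)[OF p_mem[OF U], of n] by (simp add: exceeds_def)
    qed
    have not_Plus: "c \<noteq> Plus \<longleftrightarrow> c = Minus" for c by (cases c) simp_all
    show ?thesis
    proof (cases "(id, f) \<in> l")
      case True
      have "eventually (\<lambda>n. s U n = Plus) sequentially" using lim_in[OF True] by (simp add: iff)
      then show ?thesis ..
    next
      case False
      have "eventually (\<lambda>n. s U n = Minus) sequentially"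
        using lim_notin[OF id_c f(1) False] by (simp add: iff not_Plus)
      then show ?thesis ..
    qed
  qed

  \<comment> \<open>First points stabilise: as the sign is eventually fixed, visits to \<open>A\<close> and to \<open>B\<close> give the
    separating homeomorphism opposite signs.\<close>
  have p_const: "\<exists>a. eventually (\<lambda>n. p U n = a) sequentially" if U: "open U" "U \<noteq> {}" for U
  proof (rule ccontr)
    assume "\<nexists>a. eventually (\<lambda>n. p U n = a) sequentially"
    then obtain A B where AB: "A \<subseteq> range (p U)" "B \<subseteq> range (p U)"
      "A \<inter> closure B = {}" "B \<inter> closure A = {}"
      and freq: "frequently (\<lambda>n. p U n \<in> A) sequentially" "frequently (\<lambda>n. p U n \<in> B) sequentially"
      by (rule eventually_constant_or_separated)
    have "A \<subseteq> U" "B \<subseteq> U" using AB p_mem[OF U] by auto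
    moreover have ne: "A \<noteq> {}" "B \<noteq> {}" using freq by (auto simp: frequently_def)
    ultimately obtain f where f: "f \<in> carrier homeo_plus" "{y. f y \<noteq> y} \<subseteq> U"
      "\<And>a. a \<in> A \<Longrightarrow> f a > a" "\<And>b. b \<in> B \<Longrightarrow> f b < b"
      using homeo_separating[OF U(1), of A B] AB by blast
    define V where "V = {y. f y \<noteq> id y}"
    have "f \<noteq> id" using f(3) ne(1) by auto
    \<comment> \<open>The support \<open>V\<close> of \<open>f\<close> may be smaller than \<open>U\<close>, but it contains \<open>A \<union> B\<close>, so at these times
      the first point of \<open>U\<close> is also that of \<open>V\<close>.\<close>
    have at: "(id, f) \<in> \<sigma> n \<longleftrightarrow> exceeds (s U n) (f (p U n)) (p U n)" if "p U n \<in> A \<union> B" for n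
    proof -
      have "p U n \<in> V" using that f(3,4)[of "p U n"] unfolding V_def by auto
      then have "k n V = k n U" using f(2) by (intro k_sub) (auto simp: V_def)
      then have "p V n = p U n" "s V n = s U n" unfolding p_def s_def by simp_all
      then show ?thesis using \<sigma>_iff[OF f(1) id_c \<open>f \<noteq> id\<close>, of n] unfolding V_def by simp
    qed
    obtain c where c: "eventually (\<lambda>n. s U n = c) sequentially" using s_const[OF U] by blast
    have A: "frequently (\<lambda>n. (id, f) \<in> \<sigma> n \<longleftrightarrow> c = Plus) sequentially"
      using frequently_eventually_frequently[OF freq(1) c]
    proof (rule frequently_elim1)
      fix n assume "p U n \<in> A \<and> s U n = c"
      then show "(id, f) \<in> \<sigma> n \<longleftrightarrow> c = Plus"
        using at[of n] f(3)[of "p U n"] unfolding exceeds_def by (auto simp: order.asym)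
    qed
    have B: "frequently (\<lambda>n. (id, f) \<in> \<sigma> n \<longleftrightarrow> c \<noteq> Plus) sequentially"
      using frequently_eventually_frequently[OF freq(2) c]
    proof (rule frequently_elim1)
      fix n assume "p U n \<in> B \<and> s U n = c"
      then show "(id, f) \<in> \<sigma> n \<longleftrightarrow> c \<noteq> Plus"
        using at[of n] f(4)[of "p U n"] unfolding exceeds_def
        by (cases c) (auto simp: order.asym)
    qed
    have "eventually (\<lambda>n. (id, f) \<in> \<sigma> n \<longleftrightarrow> (id, f) \<in> l) sequentially"
      using lim_in[of id f] lim_notin[OF id_c f(1)] by (cases "(id, f) \<in> l") auto
    then have "(id, f) \<in> l \<longleftrightarrow> c = Plus" "(id, f) \<in> l \<longleftrightarrow> c \<noteq> Plus"
      using frequently_ex[OF frequently_eventually_frequently[OF A]]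
        frequently_ex[OF frequently_eventually_frequently[OF B]] by blast+
    then show False by blast
  qed

  define m where "m U = (SOME a. eventually (\<lambda>n. p U n = a) sequentially)" for U
  have m: "eventually (\<lambda>n. p U n = m U) sequentially" if "open U" "U \<noteq> {}" for U
    unfolding m_def by (rule someI_ex) (rule p_const[OF that])
  have m_mem: "m U \<in> U" if "open U" "U \<noteq> {}" for U
    using eventually_happens[OF m[OF that]] p_mem[OF that] by (metis sequentially_bot)
  have k_coh: "eventually (\<lambda>n. k n V = k n U) sequentially"
    if "open U" "V \<subseteq> U" "m U \<in> V" for U V
  proof -
    have "U \<noteq> {}" using that by auto
    from m[OF that(1) this] show ?thesis
      by (rule eventually_mono) (rule k_sub, use that in auto)
  qed
  have m_coh: "m V = m U" if "open U" "open V" "V \<subseteq> U" "m U \<in> V" for U V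
  proof -
    have "U \<noteq> {}" "V \<noteq> {}" using that by auto
    from m[OF that(1) this(1)] m[OF that(2) this(2)] k_coh[OF that(1,3,4)]
    have "eventually (\<lambda>n. m V = m U) sequentially"
      by eventually_elim (simp add: p_def)
    then show ?thesis by simp
  qed
  obtain w where w: "well_order_on UNIV w" and min: "\<And>U y. open U \<Longrightarrow> y \<in> U \<Longrightarrow> (m U, y) \<in> w"
    using well_order_of_coherent_choice[of m] m_mem m_coh by metis

  \<comment> \<open>The limiting sign depends only on the point \<open>m U\<close>: if \<open>m U = m V\<close>, then this is eventually the
    first point of \<open>U \<inter> V\<close> too, and \<open>U\<close>, \<open>V\<close> and \<open>U \<inter> V\<close> share the index of their first point.\<close>
  define \<Theta> where "\<Theta> a = (SOME c. \<exists>U. open U \<and> U \<noteq> {} \<and> m U = a \<and>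
    eventually (\<lambda>n. s U n = c) sequentially)" for a
  have \<Theta>: "eventually (\<lambda>n. s U n = \<Theta> (m U)) sequentially" if U: "open U" "U \<noteq> {}" for U
  proof -
    have "\<exists>c V. open V \<and> V \<noteq> {} \<and> m V = m U \<and> eventually (\<lambda>n. s V n = c) sequentially"
      using s_const[OF U] U by blast
    from someI_ex[OF this] obtain V where V: "open V" "V \<noteq> {}" "m V = m U"
      and sV: "eventually (\<lambda>n. s V n = \<Theta> (m U)) sequentially"
      unfolding \<Theta>_def[symmetric] by blast
    have "m U \<in> U \<inter> V" "m V \<in> U \<inter> V" using m_mem U V by (metis IntI)+
    then have "eventually (\<lambda>n. k n (U \<inter> V) = k n U) sequentially"
      "eventually (\<lambda>n. k n (U \<inter> V) = k n V) sequentially"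
      using k_coh[of U "U \<inter> V"] k_coh[of V "U \<inter> V"] U(1) V(1) by simp_all
    with sV show ?thesis by eventually_elim (simp add: s_def)
  qed

  have "(g, f) \<in> l \<longleftrightarrow> (g, f) \<in> gen_dlo w \<Theta>" for f g
  proof (cases "f \<in> carrier homeo_plus \<and> g \<in> carrier homeo_plus")
    case False
    then show ?thesis using LO_D(5)[OF l] unfolding gen_dlo_def by auto
  next
    case True
    then have c: "f \<in> carrier homeo_plus" "g \<in> carrier homeo_plus" by auto
    show ?thesis
    proof (cases "f = g")
      case True
      then show ?thesis using c LO_D(1)[OF l] unfolding gen_dlo_def by (auto simp: refl_on_def)
    next
      case neq: False
      define U where "U = {y. f y \<noteq> g y}"
      have U: "open U" "U \<noteq> {}" unfolding U_def using open_differ[OF c] neq by auto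
      have gen: "(g, f) \<in> gen_dlo w \<Theta> \<longleftrightarrow> exceeds (\<Theta> (m U)) (f (m U)) (g (m U))"
        using m_mem[OF U] min[OF U(1)] by (intro gen_dlo_iff[OF w c]) (auto simp: U_def)
      have ev: "eventually (\<lambda>n. (g, f) \<in> \<sigma> n \<longleftrightarrow> (g, f) \<in> gen_dlo w \<Theta>) sequentially"
        using m[OF U] \<Theta>[OF U]
        by eventually_elim (use \<sigma>_iff[OF c neq, folded U_def] gen in simp)
      have "eventually (\<lambda>n. (g, f) \<in> \<sigma> n \<longleftrightarrow> (g, f) \<in> l) sequentially"
        using lim_in[of g f] lim_notin[OF c(2,1)] by (cases "(g, f) \<in> l") auto
      with ev have "eventually (\<lambda>n. (g, f) \<in> l \<longleftrightarrow> (g, f) \<in> gen_dlo w \<Theta>) sequentially"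
        by eventually_elim blast
      then show ?thesis by simp
    qed
  qed
  then have "l = gen_dlo w \<Theta>" by auto
  then show ?thesis unfolding general_dlos_def using w by blast
qed

theorem theorem1:
  shows "seq_closure (LO_topology homeo_plus) standard_dlos = general_dlos"
  using general_dlo_in_seq_closure seq_closure_standard_general
  unfolding general_dlos_def by blast

end
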